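(* Let $n\ge 1$ and $0\le k\le n-1$. For a rook placement $C\in\mathcal{C}(B_n,k)$ with columns $C_1,\ldots,C_n$, let $\Phi(C)$ be the unique path in $\mathcal{P}_{\mathcal{Z}}(n,n-k)$ whose sequence of edge weights is $(\epsilon_1(q),\ldots,\epsilon_n(q))=(C_1(q),\ldots,C_n(q))$. Then the map $\Phi:\mathcal{C}(B_n,k)\to\mathcal{P}_{\mathcal{Z}}(n,n-k)$ is a weight-preserving bijection, that is, $\Phi$ is a bijection and $F_C(q)=F_{\Phi(C)}(q)$ for all $C\in\mathcal{C}(B_n,k)$.
   Context: Here $q$ is an indeterminate. Rook placements. $B_n$ is the staircase board $\{(i,j):1\le i<j\le n\}$ inside the $n\times n$ grid, squares indexed as matrix entries (row $i$ from the top, column $j$ from the left). $\mathcal{C}(B_n,k)$ is the set of placements of $k$ rooks on squares of $B_n$ with at most one rook in each row and each column. A square of $B_n$ is a north-east square of $C$ if it is not occupied by a rook and lies directly north of a rook (same column, above) or directly east of a rook (same row, to the right). $\mathrm{ne}(C)$ is the number of north-east squares of $C$, and $\mathrm{ne}(C_i)$ the number of those in column $i$. The weight of the $i$th column is $C_i(q)=(q-1)^{\#\text{rooks in column } i}\,q^{\mathrm{ne}(C_i)}$, and the weight of $C$ is $F_C(q)=\prod_{i=1}^n C_i(q)=(q-1)^kq^{\mathrm{ne}(C)}$. The multigraph $\mathcal{Z}$. For a partition $\mu$, $|\mu|$ is its size, $\ell(\mu)$ its number of positive parts and $\mu'_j$ the size of the $j$th column of its Ferrers diagram. The vertices of $\mathcal{Z}$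 are all partitions (including $\emptyset$). There are edges from $\mu$ to $\lambda$ only if $\lambda$ is obtained from $\mu$ by adding one box; if this box is in column $j$: when $j=1$ there is exactly one edge, with weight $q^{|\mu|-\mu'_1}$; when $j\ge2$ there are $\mu'_{j-1}-\mu'_j$ edges, with weights $(q-1)q^{|\mu|-r}$ for $r=\mu'_j+1,\ldots,\mu'_{j-1}$ (one edge for each $r$). A path is a sequence of consecutive edges (parallel edges are distinguished). $\mathcal{P}_{\mathcal{Z}}(n,n-k)$ is the set of paths in $\mathcal{Z}$ from $\emptyset$ to some partition of $n$ with exactly $n-k$ parts. For such a path $P$, $\epsilon_i(q)$ is the weight of its $i$th edge, and its weight is $F_P(q)=\prod_{i=1}^n\epsilon_i(q)$. The existence and uniqueness of the path $\Phi(C)$ used in its definition is known (for every $C\in\mathcal{C}(B_n,k)$ there is a unique path in $\mathcal{P}_{\mathcal{Z}}(n,n-k)$ with edge weights $(C_1(q),\ldots,C_n(q))$). *)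

theory Defs
  imports "Graph_Theory.Arc_Walk" "HOL-Computational_Algebra.Polynomial"
begin

text \<open>All weights are polynomials with integer coefficients in the indeterminate \<open>q\<close>.\<close>

definition q :: "int poly" where
  "q = monom 1 1"

subsection \<open>Rook placements on the staircase board\<close>

text \<open>Squares are matrix entries (row, column), with rows numbered from the top.\<close>

definition board :: "nat \<Rightarrow> (nat \<times> nat) set" where
  "board n = {(i, j). 1 \<le> i \<and> i < j \<and> j \<le> n}"

definition rook_placements :: "nat \<Rightarrow> nat \<Rightarrow> (nat \<times> nat) set set" where
  "rook_placements n k =
     {C. C \<subseteq> board n \<and> card C = k \<and> inj_on fst C \<and> inj_on snd C}"

definition ne_squares :: "nat \<Rightarrow> (nat \<times> nat) set \<Rightarrow> (nat \<times> nat) set" where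
  "ne_squares n C =
     {(i, j). (i, j) \<in> board n \<and> (i, j) \<notin> C \<and>
        ((\<exists>i'. i < i' \<and> (i', j) \<in> C) \<or> (\<exists>j'. j' < j \<and> (i, j') \<in> C))}"

definition ne_col :: "nat \<Rightarrow> (nat \<times> nat) set \<Rightarrow> nat \<Rightarrow> nat" where
  "ne_col n C i = card {s \<in> ne_squares n C. snd s = i}"

definition col_weight :: "nat \<Rightarrow> (nat \<times> nat) set \<Rightarrow> nat \<Rightarrow> int poly" where
  "col_weight n C i = (q - 1) ^ card {s \<in> C. snd s = i} * q ^ ne_col n C i"

definition placement_weight :: "nat \<Rightarrow> (nat \<times> nat) set \<Rightarrow> int poly" where
  "placement_weight n C = (\<Prod>i = 1..n. col_weight n C i)"

subsection \<open>The multigraph of partitions\<close>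

text \<open>A partition is the weakly decreasing list of its positive parts, so its size is
  \<^const>\<open>sum_list\<close> and its number of parts is \<^const>\<open>length\<close>.\<close>

definition is_partition :: "nat list \<Rightarrow> bool" where
  "is_partition \<mu> \<longleftrightarrow> sorted_wrt (\<ge>) \<mu> \<and> (\<forall>x \<in> set \<mu>. 0 < x)"

definition ferrers :: "nat list \<Rightarrow> (nat \<times> nat) set" where
  "ferrers \<mu> = {(i, j). 1 \<le> i \<and> i \<le> length \<mu> \<and> 1 \<le> j \<and> j \<le> \<mu> ! (i - 1)}"

definition col_len :: "nat list \<Rightarrow> nat \<Rightarrow> nat" where
  "col_len \<mu> j = card {i. (i, j) \<in> ferrers \<mu>}"

definition adds_box :: "nat \<Rightarrow> nat list \<Rightarrow> nat list \<Rightarrow> bool" where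
  "adds_box j \<mu> \<nu> \<longleftrightarrow> is_partition \<mu> \<and> is_partition \<nu> \<and>
     (\<exists>i. (i, j) \<notin> ferrers \<mu> \<and> ferrers \<nu> = insert (i, j) (ferrers \<mu>))"

text \<open>\<open>FirstCol \<mu> \<nu>\<close> is the single edge for a box added in the first column;
  \<open>LaterCol \<mu> \<nu> r\<close> is the edge with label \<open>r\<close> for a box added in a later column, the label
  distinguishing parallel edges.\<close>

datatype zedge =
    FirstCol (src: "nat list") (tgt: "nat list")
  | LaterCol (src: "nat list") (tgt: "nat list") nat

definition Z :: "(nat list, zedge) pre_digraph" where
  "Z = \<lparr> verts = {\<mu>. is_partition \<mu>},
         arcs = {FirstCol \<mu> \<nu> | \<mu> \<nu>. adds_box 1 \<mu> \<nu>} \<union>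
                {LaterCol \<mu> \<nu> r | \<mu> \<nu> r. \<exists>j \<ge> 2. adds_box j \<mu> \<nu> \<and>
                   r \<in> {col_len \<mu> j + 1 .. col_len \<mu> (j - 1)}},
         tail = src, head = tgt \<rparr>"

text \<open>On the edges of \<^const>\<open>Z\<close> the natural-number subtractions never truncate, since every
  column length is at most the size.\<close>

fun edge_weight :: "zedge \<Rightarrow> int poly" where
  "edge_weight (FirstCol \<mu> \<nu>) = q ^ (sum_list \<mu> - col_len \<mu> 1)"
| "edge_weight (LaterCol \<mu> \<nu> r) = (q - 1) * q ^ (sum_list \<mu> - r)"

text \<open>Paths are lists of edges, so parallel edges give different paths.\<close>

definition zpaths :: "nat \<Rightarrow> nat \<Rightarrow> zedge list set" where
  "zpaths n m =
     {P. \<exists>\<nu>. is_partition \<nu> \<and> sum_list \<nu> = n \<and> length \<nu> = m \<and> pre_digraph.awalk Z [] P \<nu>}"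

definition path_weight :: "zedge list \<Rightarrow> int poly" where
  "path_weight P = prod_list (map edge_weight P)"

subsection \<open>The map from rook placements to paths\<close>

definition Phi :: "nat \<Rightarrow> nat \<Rightarrow> (nat \<times> nat) set \<Rightarrow> zedge list" where
  "Phi n k C = (THE P. P \<in> zpaths n (n - k) \<and>
                        map edge_weight P = map (col_weight n C) [1..<n + 1])"

end

theory Submission
  imports Defs
begin

text \<open>Both sides are encoded by the same sequences of weights. After \<open>n\<close> steps, \<open>k\<close> of which
  carry a factor \<open>q - 1\<close>, the next weight is either \<open>q ^ k\<close> or \<open>(q - 1) * q ^ e\<close> with
  \<open>k \<le> e < n\<close>. For placements, a column without a rook has weight \<open>q ^ k\<close>, and a rook on the
  free row preceded by \<open>s\<close> free rows gives \<open>e = k + s\<close>. For paths, the intervals of labels of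
  the later columns partition \<open>{1..length \<mu>}\<close>, so that each label \<open>r\<close> occurs on exactly one
  outgoing edge of \<open>\<mu>\<close>, and \<open>e = n - r\<close>. Hence both maps to weight sequences are bijections, and
  \<open>\<Phi>\<close> is one of them followed by the inverse of the other.\<close>

section \<open>Weight sequences and comparison of weights\<close>

inductive weight_seq :: "nat \<Rightarrow> nat \<Rightarrow> int poly list \<Rightarrow> bool" where
  weight_seq_Nil: "weight_seq 0 0 []"
| weight_seq_first: "weight_seq n k ws \<Longrightarrow> weight_seq (Suc n) k (ws @ [q ^ k])"
| weight_seq_later: "weight_seq n k ws \<Longrightarrow> k \<le> e \<Longrightarrow> e < n \<Longrightarrow>
    weight_seq (Suc n) (Suc k) (ws @ [(q - 1) * q ^ e])"

text \<open>At the point 1 the left side is 1 and the right side is 0. Hence a single weight already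
  reveals whether a factor \<open>q - 1\<close> is present.\<close>

lemma q_power_neq: "q ^ a \<noteq> (q - 1) * q ^ b"
proof
  assume "q ^ a = (q - 1) * q ^ b"
  then have "poly (q ^ a) 1 = poly ((q - 1) * q ^ b) 1" by simp
  then show False by (simp add: q_def poly_monom)
qed

lemma q_minus_1_power_eq_iff: "(q - 1) * q ^ a = (q - 1) * q ^ b \<longleftrightarrow> a = b"
proof
  assume "(q - 1) * q ^ a = (q - 1) * q ^ b"
  \<comment> \<open>At the point 2 the factor \<open>q - 1\<close> becomes 1, and distinct powers of
    2 differ.\<close>
  then have "poly ((q - 1) * q ^ a) 2 = poly ((q - 1) * q ^ b) 2" by (simp only:)
  then show "a = b" by (simp add: q_def poly_monom)
qed simp

section \<open>Partitions and their outgoing edges\<close>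

lemma ferrers_Suc_iff: "(Suc i, j) \<in> ferrers \<mu> \<longleftrightarrow> i < length \<mu> \<and> 1 \<le> j \<and> j \<le> \<mu> ! i"
  by (auto simp: ferrers_def)

lemma ferrers_pos: "(i, j) \<in> ferrers \<mu> \<Longrightarrow> 1 \<le> i \<and> 1 \<le> j"
  by (auto simp: ferrers_def)

lemma finite_col: "finite {i. (i, j) \<in> ferrers \<mu>}"
  by (rule finite_subset[of _ "{..length \<mu>}"]) (auto simp: ferrers_def)

lemma ferrers_col_mono:
  assumes "is_partition \<mu>" "(i, j) \<in> ferrers \<mu>" "1 \<le> i'" "i' \<le> i"
  shows "(i', j) \<in> ferrers \<mu>"
proof -
  have "\<mu> ! (i - 1) \<le> \<mu> ! (i' - 1)"
  proof (cases "i' = i")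
    case False
    then have "i' - 1 < i - 1" "i - 1 < length \<mu>"
      using assms by (auto simp: ferrers_def)
    then show ?thesis
      using assms(1) by (auto simp: is_partition_def sorted_wrt_iff_nth_less)
  qed simp
  then show ?thesis
    using assms by (auto simp: ferrers_def)
qed

text \<open>Columns are closed upwards because the parts weakly decrease. So \<open>col_len\<close>,
  defined as a cardinality, is also the number of the last row that the column meets.\<close>

lemma col_eq_interval:
  assumes "is_partition \<mu>"
  shows "{i. (i, j) \<in> ferrers \<mu>} = {1..col_len \<mu> j}"
proof (cases "{i. (i, j) \<in> ferrers \<mu>} = {}")
  case True
  then show ?thesis by (simp add: col_len_def)
next
  case False
  define M where "M = Max {i. (i, j) \<in> ferrers \<mu>}"
  have "M \<in> {i. (i, j) \<in> ferrers \<mu>}" and "\<And>i. (i, j) \<in> ferrers \<mu> \<Longrightarrow> i \<le> M"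
    using Max_in[OF finite_col False] Max_ge[OF finite_col] by (auto simp: M_def)
  then have "{i. (i, j) \<in> ferrers \<mu>} = {1..M}"
    using ferrers_col_mono[OF assms] ferrers_pos by fastforce
  then show ?thesis by (simp add: col_len_def)
qed

lemma ferrers_iff_col_len:
  "is_partition \<mu> \<Longrightarrow> (i, j) \<in> ferrers \<mu> \<longleftrightarrow> 1 \<le> i \<and> i \<le> col_len \<mu> j"
  using col_eq_interval[of \<mu> j] by auto

lemma col_len_1: "is_partition \<mu> \<Longrightarrow> col_len \<mu> 1 = length \<mu>"
proof -
  assume "is_partition \<mu>"
  then have "\<And>i. i < length \<mu> \<Longrightarrow> 0 < \<mu> ! i" by (simp add: is_partition_def)
  then have "{i. (i, 1) \<in> ferrers \<mu>} = {1..length \<mu>}"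
    by (force simp: ferrers_def Suc_le_eq)
  then show ?thesis by (simp add: col_len_def)
qed

lemma card_ferrers: "card (ferrers \<mu>) = sum_list \<mu>"
proof -
  have "ferrers \<mu> = (SIGMA i:{1..length \<mu>}. {1..\<mu> ! (i - 1)})"
    by (auto simp: ferrers_def)
  then have "card (ferrers \<mu>) = (\<Sum>i=1..length \<mu>. \<mu> ! (i - 1))" by simp
  also have "\<dots> = (\<Sum>i<length \<mu>. \<mu> ! i)"
    by (rule sum.reindex_bij_witness[of _ Suc "\<lambda>i. i - 1"]) auto
  finally show ?thesis by (simp add: sum_list_sum_nth atLeast0LessThan)
qed

lemma finite_ferrers: "finite (ferrers \<mu>)"
proof -
  have "ferrers \<mu> \<subseteq> (SIGMA i:{1..length \<mu>}. {1..\<mu> ! (i - 1)})"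
    by (auto simp: ferrers_def)
  then show ?thesis by (rule finite_subset) auto
qed

text \<open>The first column of the diagram gives the number of parts, and its rows give the
  parts.\<close>

lemma ferrers_inject:
  assumes "is_partition \<mu>" "is_partition \<nu>" "ferrers \<mu> = ferrers \<nu>"
  shows "\<mu> = \<nu>"
proof (rule nth_equalityI)
  show len: "length \<mu> = length \<nu>"
    using assms col_len_1[of \<mu>] col_len_1[of \<nu>] by (simp add: col_len_def)
  fix i assume "i < length \<mu>"
  with len have "{j. (Suc i, j) \<in> ferrers \<mu>} = {1..\<mu> ! i}" "{j. (Suc i, j) \<in> ferrers \<nu>} = {1..\<nu> ! i}"
    by (auto simp: ferrers_Suc_iff)
  then show "\<mu> ! i = \<nu> ! i" using assms(3) by (metis card_atLeastAtMost diff_Suc_1)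
qed

text \<open>The row in \<open>adds_box\<close> is only asserted to exist. It is forced, since column
  \<open>j\<close> must be an initial interval of rows both before and after the insertion.\<close>

lemma adds_box_ferrers:
  assumes "adds_box j \<mu> \<nu>"
  shows "ferrers \<nu> = insert (Suc (col_len \<mu> j), j) (ferrers \<mu>)"
    and "(Suc (col_len \<mu> j), j) \<notin> ferrers \<mu>"
proof -
  from assms obtain i where i: "is_partition \<mu>" "is_partition \<nu>"
    "(i, j) \<notin> ferrers \<mu>" "ferrers \<nu> = insert (i, j) (ferrers \<mu>)"
    by (auto simp: adds_box_def)
  have "{i'. (i', j) \<in> ferrers \<nu>} = insert i {i'. (i', j) \<in> ferrers \<mu>}"
    using i(4) by auto
  then have eq: "{1..col_len \<nu> j} = insert i {1..col_len \<mu> j}"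
    using col_eq_interval i(1,2) by metis
  have "card (insert i {1..col_len \<mu> j}) = Suc (col_len \<mu> j)"
    using i(3) col_eq_interval[OF i(1), of j] by (subst card_insert_disjoint) auto
  with eq have "col_len \<nu> j = Suc (col_len \<mu> j)"
    by (metis card_atLeastAtMost diff_Suc_1)
  \<comment> \<open>The last row of the new column lies beyond the old column, so it can only be the
    inserted row \<open>i\<close>.\<close>
  then have "Suc (col_len \<mu> j) \<in> insert i {1..col_len \<mu> j}"
    using eq by (metis atLeastAtMost_iff le_refl One_nat_def Suc_le_mono zero_le)
  then have "i = Suc (col_len \<mu> j)" by auto
  then show "ferrers \<nu> = insert (Suc (col_len \<mu> j), j) (ferrers \<mu>)"
    "(Suc (col_len \<mu> j), j) \<notin> ferrers \<mu>" using i by auto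
qed

lemma adds_box_unique: "adds_box j \<mu> \<nu> \<Longrightarrow> adds_box j \<mu> \<nu>' \<Longrightarrow> \<nu> = \<nu>'"
  using ferrers_inject adds_box_ferrers(1) by (metis adds_box_def)

lemma adds_box_sum_list: "adds_box j \<mu> \<nu> \<Longrightarrow> sum_list \<nu> = Suc (sum_list \<mu>)"
  using adds_box_ferrers[of j \<mu> \<nu>] by (simp flip: card_ferrers add: finite_ferrers)

lemma adds_box_length:
  assumes "adds_box j \<mu> \<nu>"
  shows "length \<nu> = (if j = 1 then Suc (length \<mu>) else length \<mu>)"
proof -
  have p: "is_partition \<mu>" "is_partition \<nu>" using assms by (auto simp: adds_box_def)
  have "{i. (i, 1) \<in> ferrers \<nu>} =
      (if j = 1 then insert (Suc (col_len \<mu> j)) {i. (i, 1) \<in> ferrers \<mu>} else {i. (i, 1) \<in> ferrers \<mu>})"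
    using adds_box_ferrers(1)[OF assms] by auto
  then have "col_len \<nu> 1 = (if j = 1 then Suc (col_len \<mu> 1) else col_len \<mu> 1)"
    using adds_box_ferrers(2)[OF assms] finite_col[of 1 \<mu>]
    by (auto simp: col_len_def)
  then show ?thesis using p by (simp add: col_len_1[simplified])
qed

lemma length_le_sum_list: "is_partition \<mu> \<Longrightarrow> length \<mu> \<le> sum_list \<mu>"
  unfolding is_partition_def by (induction \<mu>) (auto simp: Suc_le_eq add_strict_increasing)

lemma adds_box_first: "is_partition \<mu> \<Longrightarrow> adds_box 1 \<mu> (\<mu> @ [1])"
  unfolding adds_box_def
  by (intro conjI exI[of _ "Suc (length \<mu>)"])
    (auto simp: is_partition_def sorted_wrt_append ferrers_def nth_append Suc_le_eq
      split: if_splits dest: nth_mem)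

text \<open>Membership of \<open>r\<close> in the interval means that row \<open>r\<close> reaches
  column \<open>j - 1\<close> but not column \<open>j\<close>, that is, ends exactly in column
  \<open>j - 1\<close>. So every label from 1 to \<open>length \<mu>\<close> belongs to exactly one
  column.\<close>

lemma label_iff:
  assumes "is_partition \<mu>" "2 \<le> j"
  shows "r \<in> {col_len \<mu> j + 1..col_len \<mu> (j - 1)} \<longleftrightarrow>
    1 \<le> r \<and> r \<le> length \<mu> \<and> j = Suc (\<mu> ! (r - 1))"
proof -
  have "r \<in> {col_len \<mu> j + 1..col_len \<mu> (j - 1)} \<longleftrightarrow>
      (r, j - 1) \<in> ferrers \<mu> \<and> (r, j) \<notin> ferrers \<mu>"
    unfolding ferrers_iff_col_len[OF assms(1)] by auto
  also have "\<dots> \<longleftrightarrow> 1 \<le> r \<and> r \<le> length \<mu> \<and> j = Suc (\<mu> ! (r - 1))"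
    using assms(2) by (auto simp: ferrers_def)
  finally show ?thesis .
qed

text \<open>The box need not go into row \<open>r\<close>: it goes into the topmost row of the same
  length, which is row \<open>Suc c\<close>, because \<open>c\<close> counts the rows that are
  longer.\<close>

lemma adds_box_later:
  assumes "is_partition \<mu>" "1 \<le> r" "r \<le> length \<mu>"
  shows "\<exists>\<nu>. adds_box (Suc (\<mu> ! (r - 1))) \<mu> \<nu>"
proof -
  define j where "j = Suc (\<mu> ! (r - 1))"
  define c where "c = col_len \<mu> j"
  have pos: "\<And>i. i < length \<mu> \<Longrightarrow> 0 < \<mu> ! i"
    using assms(1) by (simp add: is_partition_def)
  have j2: "2 \<le> j" using assms pos[of "r - 1"] by (simp add: j_def Suc_le_eq)
  then have "r \<in> {c + 1..col_len \<mu> (j - 1)}"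
    using label_iff[OF assms(1)] assms(2,3) unfolding c_def j_def by blast
  \<comment> \<open>The interval contains \<open>r\<close>, so it is nonempty and contains its least
    element \<open>Suc c\<close>; row \<open>Suc c\<close> therefore has the length of row
    \<open>r\<close>.\<close>
  then have in1: "(Suc c, j - 1) \<in> ferrers \<mu>"
    by (simp add: ferrers_iff_col_len[OF assms(1)])
  have out: "(Suc c, j) \<notin> ferrers \<mu>"
    by (simp add: ferrers_iff_col_len[OF assms(1)] c_def)
  from in1 out j2 have c: "c < length \<mu>" "j = Suc (\<mu> ! c)"
    by (auto simp: ferrers_Suc_iff)
  \<comment> \<open>Rows above row \<open>Suc c\<close> already reach column \<open>j\<close>, so
    lengthening that row keeps the parts weakly decreasing.\<close>
  have above: "j \<le> \<mu> ! i" if "i < c" for i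
    using that ferrers_iff_col_len[OF assms(1), of "Suc i" j]
    by (auto simp: ferrers_Suc_iff c_def)
  let ?\<nu> = "\<mu>[c := j]"
  have s: "\<mu> ! b \<le> \<mu> ! a" if "a < b" "b < length \<mu>" for a b
    using assms(1) that by (auto simp: is_partition_def sorted_wrt_iff_nth_less)
  have "is_partition ?\<nu>"
    unfolding is_partition_def
  proof
    show "sorted_wrt (\<ge>) ?\<nu>"
      using c above by (auto simp: sorted_wrt_iff_nth_less nth_list_update s le_SucI)
    show "\<forall>x\<in>set ?\<nu>. 0 < x"
      using pos j2 c(1) by (auto simp: in_set_conv_nth nth_list_update)
  qed
  moreover have "ferrers ?\<nu> = insert (Suc c, j) (ferrers \<mu>)"
  proof -
    have "(i, l) \<in> ferrers ?\<nu> \<longleftrightarrow> (i, l) \<in> insert (Suc c, j) (ferrers \<mu>)" for i l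
    proof (cases i)
      case 0
      then show ?thesis by (auto simp: ferrers_def)
    next
      case (Suc i')
      then show ?thesis using c by (auto simp: ferrers_Suc_iff nth_list_update)
    qed
    then show ?thesis by auto
  qed
  ultimately show ?thesis
    using assms(1) out unfolding adds_box_def j_def by blast
qed

section \<open>Arcs of \<open>Z\<close> and their weights\<close>

lemma wf_digraph_Z: "wf_digraph Z"
  by unfold_locales (auto simp: Z_def adds_box_def)

text \<open>Replaces the existentially quantified column of a later edge by the column that its
  label determines.\<close>

lemma arcs_Z_cases:
  assumes "e \<in> arcs Z"
  obtains (first) \<mu> \<nu> where "e = FirstCol \<mu> \<nu>" "adds_box 1 \<mu> \<nu>"
  | (later) \<mu> \<nu> r where "e = LaterCol \<mu> \<nu> r" "1 \<le> r" "r \<le> length \<mu>"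
      "adds_box (Suc (\<mu> ! (r - 1))) \<mu> \<nu>" "\<mu> ! (r - 1) \<noteq> 0"
proof -
  consider \<mu> \<nu> where "e = FirstCol \<mu> \<nu>" "adds_box 1 \<mu> \<nu>"
    | \<mu> \<nu> r j where "e = LaterCol \<mu> \<nu> r" "2 \<le> j" "adds_box j \<mu> \<nu>"
        "r \<in> {col_len \<mu> j + 1..col_len \<mu> (j - 1)}"
    using assms by (auto simp: Z_def)
  then show thesis
  proof cases
    case 1
    then show ?thesis by (rule first)
  next
    case 2
    then have "is_partition \<mu>" by (simp add: adds_box_def)
    from label_iff[OF this 2(2)] 2 show ?thesis by (intro later) auto
  qed
qed

text \<open>The factor \<open>q - 1\<close> tells the kind of edge, the exponent gives the label,
  the label gives the column, and the column gives the target.\<close>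

lemma edge_weight_inject:
  assumes "e \<in> arcs Z" "e' \<in> arcs Z" "src e = src e'" "edge_weight e = edge_weight e'"
  shows "e = e'"
  using assms(1)
proof (cases rule: arcs_Z_cases)
  case (first \<mu> \<nu>)
  from assms(2) show ?thesis
  proof (cases rule: arcs_Z_cases)
    case first': (first \<mu>' \<nu>')
    then show ?thesis using first assms(3) adds_box_unique by auto
  next
    case later
    then show ?thesis using first assms(4) q_power_neq by auto
  qed
next
  case (later \<mu> \<nu> r)
  then have p: "is_partition \<mu>" by (simp add: adds_box_def)
  from assms(2) show ?thesis
  proof (cases rule: arcs_Z_cases)
    case first
    then show ?thesis using later assms(4) q_power_neq by (metis edge_weight.simps)
  next
    case later': (later \<mu>' \<nu>' r')
    have "sum_list \<mu> - r = sum_list \<mu> - r'"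
      using later(1) later'(1) assms(3,4) by (simp add: q_minus_1_power_eq_iff del: mult_cancel_left)
    \<comment> \<open>Both labels are at most \<open>length \<mu>\<close>, hence at most the size,
      so neither subtraction truncates.\<close>
    then have "r = r'"
      using later later' assms(3) length_le_sum_list[OF p] by auto
    then show ?thesis using later later' assms(3) adds_box_unique by auto
  qed
qed

text \<open>The second parameter of \<open>weight_seq\<close> counts the boxes outside the first
  column. For a later edge, \<open>1 \<le> r\<close> and \<open>r \<le> length \<mu>\<close> are
  exactly the bounds required of the exponent.\<close>

lemma weight_seq_edge:
  assumes "e \<in> arcs Z" "weight_seq (sum_list (src e)) (sum_list (src e) - length (src e)) ws"
  shows "weight_seq (sum_list (tgt e)) (sum_list (tgt e) - length (tgt e)) (ws @ [edge_weight e])"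
  using assms(1)
proof (cases rule: arcs_Z_cases)
  case (first \<mu> \<nu>)
  then have p: "is_partition \<mu>" by (simp add: adds_box_def)
  show ?thesis
    using first assms(2) adds_box_length[of 1 \<mu> \<nu>] adds_box_sum_list[of 1 \<mu> \<nu>] weight_seq_first
    by (simp add: col_len_1[OF p, simplified])
next
  case (later \<mu> \<nu> r)
  then have p: "is_partition \<mu>" by (simp add: adds_box_def)
  let ?n = "sum_list \<mu>"
  have "weight_seq (Suc ?n) (Suc (?n - length \<mu>)) (ws @ [(q - 1) * q ^ (?n - r)])"
    using later assms(2) length_le_sum_list[OF p] by (intro weight_seq_later) auto
  then show ?thesis
    using later adds_box_length[OF later(4)] adds_box_sum_list[OF later(4)]
      length_le_sum_list[OF p] by (simp add: Suc_diff_le)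
qed

section \<open>Paths and weight sequences\<close>

interpretation Z: wf_digraph Z by (rule wf_digraph_Z)

text \<open>Paths are extended at the end, as weight sequences are. The general append rule is
  removed from the simpset afterwards so that this form is the one applied.\<close>

lemma awalk_Z_snoc:
  "Z.awalk u (p @ [e]) v \<longleftrightarrow> Z.awalk u p (src e) \<and> e \<in> arcs Z \<and> v = tgt e"
proof -
  have "tail Z e = src e" "head Z e = tgt e" by (simp_all add: Z_def)
  then show ?thesis
    using Z.head_in_verts[of e] Z.tail_in_verts[of e]
    by (auto simp: Z.awalk_append_iff Z.awalk_simps Z.awalk_def)
qed

declare Z.awalk_append_iff [simp del]

lemma awalk_Z_Nil: "Z.awalk [] [] v \<longleftrightarrow> v = []"
  by (auto simp: Z.awalk_Nil_iff) (auto simp: Z_def is_partition_def)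

lemma awalk_Z_is_partition: "Z.awalk u p v \<Longrightarrow> is_partition v"
  using Z.awalk_last_in_verts by (force simp: Z_def)

lemma weight_seq_awalk:
  "Z.awalk [] p \<nu> \<Longrightarrow> weight_seq (sum_list \<nu>) (sum_list \<nu> - length \<nu>) (map edge_weight p)"
proof (induction p arbitrary: \<nu> rule: rev_induct)
  case Nil
  then show ?case by (simp add: awalk_Z_Nil weight_seq_Nil)
next
  case (snoc e p)
  then show ?case using weight_seq_edge by (simp add: awalk_Z_snoc)
qed

text \<open>Equality of the endpoints is part of the conclusion: by induction it gives the two last
  edges a common source, as \<open>edge_weight_inject\<close> needs.\<close>

lemma awalk_edge_weight_inject:
  "Z.awalk [] p \<nu> \<Longrightarrow> Z.awalk [] p' \<nu>' \<Longrightarrow> map edge_weight p = map edge_weight p' \<Longrightarrow>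
    p = p' \<and> \<nu> = \<nu>'"
proof (induction p arbitrary: \<nu> p' \<nu>' rule: rev_induct)
  case Nil
  then show ?case by (simp add: awalk_Z_Nil)
next
  case (snoc e p)
  then obtain e0 p0 where p': "p' = p0 @ [e0]"
    by (cases p' rule: rev_cases) auto
  with snoc.prems have "p = p0 \<and> src e = src e0"
    by (intro snoc.IH) (auto simp: awalk_Z_snoc)
  with snoc.prems p' edge_weight_inject show ?case
    by (simp add: awalk_Z_snoc) blast
qed

text \<open>The additive form \<open>length \<nu> + k = n\<close> also records
  \<open>k \<le> n\<close>.\<close>

lemma awalk_exists:
  "weight_seq n k ws \<Longrightarrow>
    \<exists>p \<nu>. Z.awalk [] p \<nu> \<and> sum_list \<nu> = n \<and> length \<nu> + k = n \<and> map edge_weight p = ws"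
proof (induction rule: weight_seq.induct)
  case weight_seq_Nil
  then show ?case by (intro exI[of _ "[]"]) (simp add: awalk_Z_Nil)
next
  case (weight_seq_first n k ws)
  then obtain p \<mu> where p: "Z.awalk [] p \<mu>" "sum_list \<mu> = n" "length \<mu> + k = n"
    "map edge_weight p = ws" by blast
  then have \<mu>: "is_partition \<mu>" by (simp add: awalk_Z_is_partition)
  then have box: "adds_box 1 \<mu> (\<mu> @ [1])" by (rule adds_box_first)
  let ?e = "FirstCol \<mu> (\<mu> @ [1])"
  have "Z.awalk [] (p @ [?e]) (\<mu> @ [1])"
    using p box by (simp add: awalk_Z_snoc) (simp add: Z_def)
  moreover have "edge_weight ?e = q ^ k"
    using p(2) col_len_1[OF \<mu>] by (simp flip: p(3))
  ultimately show ?case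
    using p by (intro exI[of _ "p @ [?e]"] exI[of _ "\<mu> @ [1]"]) simp
next
  case (weight_seq_later n k ws e)
  then obtain p \<mu> where p: "Z.awalk [] p \<mu>" "sum_list \<mu> = n" "length \<mu> + k = n"
    "map edge_weight p = ws" by blast
  then have \<mu>: "is_partition \<mu>" by (simp add: awalk_Z_is_partition)
  \<comment> \<open>Solves \<open>n - r = e\<close> for the label; \<open>k \<le> e\<close> and
    \<open>e < n\<close> become \<open>r \<le> length \<mu>\<close> and
    \<open>1 \<le> r\<close>.\<close>
  define r where "r = n - e"
  have r: "1 \<le> r" "r \<le> length \<mu>" "n - r = e"
    using weight_seq_later p(3) by (auto simp: r_def)
  define j where "j = Suc (\<mu> ! (r - 1))"
  from r \<mu> have j: "2 \<le> j" by (auto simp: is_partition_def j_def Suc_le_eq)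
  obtain \<nu> where \<nu>: "adds_box j \<mu> \<nu>"
    using adds_box_later[OF \<mu> r(1,2)] by (auto simp: j_def)
  have "r \<in> {col_len \<mu> j + 1..col_len \<mu> (j - 1)}"
    using label_iff[OF \<mu> j] r by (simp add: j_def)
  then have "LaterCol \<mu> \<nu> r \<in> arcs Z"
    using \<nu> j by (auto simp: Z_def)
  then have "Z.awalk [] (p @ [LaterCol \<mu> \<nu> r]) \<nu>"
    using p by (simp add: awalk_Z_snoc)
  moreover have "sum_list \<nu> = Suc n" "length \<nu> = length \<mu>"
    using adds_box_sum_list[OF \<nu>] adds_box_length[OF \<nu>] p j by auto
  ultimately show ?case
    using p r by (intro exI[of _ "p @ [LaterCol \<mu> \<nu> r]"] exI[of _ \<nu>]) simp
qed

lemma bij_betw_zpaths_weight_seq: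
  assumes "k \<le> n"
  shows "bij_betw (map edge_weight) (zpaths n (n - k)) {ws. weight_seq n k ws}"
  unfolding bij_betw_def
proof
  show "inj_on (map edge_weight) (zpaths n (n - k))"
    using awalk_edge_weight_inject by (fastforce simp: zpaths_def inj_on_def)
  show "map edge_weight ` zpaths n (n - k) = {ws. weight_seq n k ws}"
  proof (intro equalityI subsetI)
    fix ws assume "ws \<in> map edge_weight ` zpaths n (n - k)"
    then obtain p \<nu> where p: "ws = map edge_weight p" "Z.awalk [] p \<nu>" "sum_list \<nu> = n"
      "length \<nu> = n - k" by (auto simp: zpaths_def)
    then show "ws \<in> {ws. weight_seq n k ws}"
      using weight_seq_awalk[OF p(2)] assms by simp
  next
    fix ws assume "ws \<in> {ws. weight_seq n k ws}"
    then obtain p \<nu> where "Z.awalk [] p \<nu>" "sum_list \<nu> = n" "length \<nu> + k = n"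
      "map edge_weight p = ws" using awalk_exists by blast
    then show "ws \<in> map edge_weight ` zpaths n (n - k)"
      using awalk_Z_is_partition by (fastforce simp: zpaths_def)
  qed
qed

section \<open>Rook placements and weight sequences\<close>

lemma board_Suc: "board n \<subseteq> board (Suc n)"
  by (auto simp: board_def)

lemma finite_board: "finite (board n)"
  by (rule finite_subset[of _ "{..n} \<times> {..n}"]) (auto simp: board_def)

lemma rook_placements_0: "C \<in> rook_placements 0 k \<longleftrightarrow> C = {} \<and> k = 0"
  proof -
  have "board 0 = {}" by (auto simp: board_def)
  then show ?thesis by (auto simp: rook_placements_def)
qed

lemma rook_placements_SucI1: "C \<in> rook_placements n k \<Longrightarrow> C \<in> rook_placements (Suc n) k"
  using board_Suc by (auto simp: rook_placements_def)

lemma rook_placements_SucI2: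
  assumes "C \<in> rook_placements n k" "r \<in> {1..n} - fst ` C"
  shows "insert (r, Suc n) C \<in> rook_placements (Suc n) (Suc k)"
proof -
  have C: "C \<subseteq> board n" "card C = k" "inj_on fst C" "inj_on snd C"
    using assms(1) by (auto simp: rook_placements_def)
  have "finite C" using C(1) finite_board finite_subset by blast
  moreover have new: "Suc n \<notin> snd ` C" using C(1) by (auto simp: board_def)
  then have "(r, Suc n) \<notin> C" by force
  moreover have "insert (r, Suc n) C \<subseteq> board (Suc n)"
    using C(1) assms(2) by (auto simp: board_def)
  ultimately show ?thesis
    using C assms(2) new by (auto simp: rook_placements_def)
qed

text \<open>Column \<open>Suc n\<close> holds at most one rook. Removing it gives a decomposition
  parallel to the rules of \<open>weight_seq\<close>.\<close>

lemma rook_placements_Suc_cases: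
  assumes "C \<in> rook_placements (Suc n) k"
  obtains (empty) "C \<in> rook_placements n k"
  | (rook) r C' k' where "k = Suc k'" "C' \<in> rook_placements n k'" "r \<in> {1..n} - fst ` C'"
      "C = insert (r, Suc n) C'"
proof -
  have C: "C \<subseteq> board (Suc n)" "card C = k" "inj_on fst C" "inj_on snd C"
    using assms by (auto simp: rook_placements_def)
  show thesis
  proof (cases "Suc n \<in> snd ` C")
    case False
    then have "C \<subseteq> board n" using C(1) by (force simp: board_def le_Suc_eq)
    with C show thesis by (intro empty) (simp add: rook_placements_def)
  next
    case True
    then obtain r where r: "(r, Suc n) \<in> C" by auto
    define C' where "C' = C - {(r, Suc n)}"
    have CC': "C = insert (r, Suc n) C'" "(r, Suc n) \<notin> C'" using r by (auto simp: C'_def)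
    have "Suc n \<notin> snd ` C'"
      using C(4) CC'(2) unfolding CC'(1) inj_on_insert by simp
    then have sub: "C' \<subseteq> board n" using C(1) CC' by (force simp: board_def le_Suc_eq)
    then have "finite C'" using finite_board finite_subset by blast
    then have "k = Suc (card C')" using C(2) CC' by simp
    moreover have "C' \<in> rook_placements n (card C')"
      using sub C(3,4) CC' by (auto simp: rook_placements_def)
    moreover have "r \<in> {1..n} - fst ` C'"
      using C(1,3) CC'(2) unfolding CC'(1) inj_on_insert by (auto simp: board_def)
    ultimately show thesis using CC' by (intro rook) auto
  qed
qed

text \<open>North-east squares in column \<open>i\<close> are caused only by rooks in column
  \<open>i\<close> or to its west, so rooks further east and the size of the board do not
  matter.\<close>

lemma col_weight_cong:
  assumes "i \<le> n" "i \<le> m" and mem: "\<And>a b. b \<le> i \<Longrightarrow> (a, b) \<in> C \<longleftrightarrow> (a, b) \<in> D"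
  shows "col_weight n C i = col_weight m D i"
proof -
  have "s \<in> C \<and> snd s = i \<longleftrightarrow> s \<in> D \<and> snd s = i" for s
    using mem by (cases s) auto
  moreover have "s \<in> ne_squares n C \<and> snd s = i \<longleftrightarrow> s \<in> ne_squares m D \<and> snd s = i" for s
  proof (cases s)
    case (Pair a b)
    have "(a, i) \<in> ne_squares n C \<longleftrightarrow> (a, i) \<in> ne_squares m D"
      using assms(1,2) mem less_imp_le unfolding ne_squares_def board_def
      by (simp cong: conj_cong)
    then show ?thesis using Pair by auto
  qed
  ultimately show ?thesis by (simp only: col_weight_def ne_col_def)
qed

section \<open>Adding a last column\<close>

lemma col_weights_Suc:
  "map (col_weight (Suc n) C) [1..<Suc n + 1] =
    map (col_weight n C) [1..<n + 1] @ [col_weight (Suc n) C (Suc n)]"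
proof -
  have "col_weight (Suc n) C i = col_weight n C i" if "i \<le> n" for i
    using that by (intro col_weight_cong) simp_all
  then show ?thesis by auto
qed

lemma col_weights_Suc_insert:
  "map (col_weight (Suc n) (insert (r, Suc n) C)) [1..<Suc n + 1] =
    map (col_weight n C) [1..<n + 1] @ [col_weight (Suc n) (insert (r, Suc n) C) (Suc n)]"
proof -
  have "col_weight (Suc n) (insert (r, Suc n) C) i = col_weight n C i" if "i \<le> n" for i
    using that by (intro col_weight_cong) simp_all
  then show ?thesis by auto
qed

lemma last_col_squares:
  assumes "C \<subseteq> board n"
  shows "(i, Suc n) \<notin> C" and "i \<in> fst ` C \<longleftrightarrow> (\<exists>j < Suc n. (i, j) \<in> C)"
    and "(i, j) \<in> C \<Longrightarrow> 1 \<le> i \<and> i < Suc n"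
proof -
  have board: "1 \<le> a \<and> a < b \<and> b \<le> n" if "(a, b) \<in> C" for a b
    using assms that by (auto simp: board_def)
  then show "(i, Suc n) \<notin> C" by fastforce
  show row: "i \<in> fst ` C \<longleftrightarrow> (\<exists>j < Suc n. (i, j) \<in> C)"
  proof
    assume "i \<in> fst ` C"
    then obtain b where "(i, b) \<in> C" by auto
    with board[OF this] show "\<exists>j < Suc n. (i, j) \<in> C" by (auto simp: less_Suc_eq_le)
  next
    assume "\<exists>j < Suc n. (i, j) \<in> C"
    then obtain b where "(i, b) \<in> C" by auto
    then show "i \<in> fst ` C" by (rule image_eqI[rotated]) simp
  qed
  show "1 \<le> i \<and> i < Suc n" if "(i, j) \<in> C"
    using board[OF that] by simp
qed

text \<open>With no rook in the last column, its north-east squares are those east of a rook, one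
  for each of the \<open>k\<close> occupied rows.\<close>

lemma last_col_weight_empty:
  assumes "C \<in> rook_placements n k"
  shows "col_weight (Suc n) C (Suc n) = q ^ k"
proof -
  have C: "C \<subseteq> board n" "card C = k" "inj_on fst C"
    using assms by (auto simp: rook_placements_def)
  have "(i, Suc n) \<in> ne_squares (Suc n) C \<longleftrightarrow> i \<in> fst ` C" for i
    using last_col_squares[OF C(1)] by (auto simp: ne_squares_def board_def)
  then have "{s \<in> ne_squares (Suc n) C. snd s = Suc n} = (\<lambda>i. (i, Suc n)) ` fst ` C"
    by auto
  then have "ne_col (Suc n) C (Suc n) = k"
    using C by (simp add: ne_col_def card_image inj_on_def)
  moreover have "{s \<in> C. snd s = Suc n} = {}" using C(1) by (auto simp: board_def)
  then have "card {s \<in> C. snd s = Suc n} = 0" by (simp only: card.empty)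
  ultimately show ?thesis by (simp add: col_weight_def)
qed

text \<open>Each row occupied by \<open>C\<close> contributes one square, whether above or below row
  \<open>r\<close>; besides these, exactly the free rows above row \<open>r\<close> do.\<close>

lemma last_col_weight_rook:
  assumes "C \<in> rook_placements n k" "r \<in> {1..n} - fst ` C"
  shows "col_weight (Suc n) (insert (r, Suc n) C) (Suc n) =
    (q - 1) * q ^ (k + card {i \<in> {1..n} - fst ` C. i < r})"
proof -
  have C: "C \<subseteq> board n" "card C = k" "inj_on fst C"
    using assms by (auto simp: rook_placements_def)
  have fin: "finite C" using C(1) finite_board finite_subset by blast
  let ?F = "{i \<in> {1..n} - fst ` C. i < r}"
  have "{s \<in> ne_squares (Suc n) (insert (r, Suc n) C). snd s = Suc n} =
      (\<lambda>i. (i, Suc n)) ` (fst ` C \<union> ?F)"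
  proof -
    have "(i, Suc n) \<in> ne_squares (Suc n) (insert (r, Suc n) C) \<longleftrightarrow> i \<in> fst ` C \<union> ?F" for i
      using last_col_squares[OF C(1)] assms(2) by (auto simp: ne_squares_def board_def)
    then show ?thesis by auto
  qed
  then have "ne_col (Suc n) (insert (r, Suc n) C) (Suc n) = card (fst ` C \<union> ?F)"
    by (simp add: ne_col_def card_image inj_on_def)
  also have "\<dots> = k + card ?F"
    using C fin by (subst card_Un_disjoint) (auto simp: card_image)
  finally have "ne_col (Suc n) (insert (r, Suc n) C) (Suc n) = k + card ?F" .
  moreover have "{s \<in> insert (r, Suc n) C. snd s = Suc n} = {(r, Suc n)}"
    using C(1) by (auto simp: board_def)
  ultimately show ?thesis by (simp add: col_weight_def)
qed

text \<open>The rank is strictly increasing and stays below \<open>card A\<close>, so counting gives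
  surjectivity. Applied to the free rows, it turns the choice of a row into the choice of an
  exponent.\<close>

lemma bij_betw_rank:
  fixes A :: "nat set"
  assumes "finite A"
  shows "bij_betw (\<lambda>a. card {x \<in> A. x < a}) A {..<card A}"
proof -
  have less: "card {x \<in> A. x < a} < card {x \<in> A. x < b}" if "a \<in> A" "a < b" for a b
    using that assms by (intro psubset_card_mono) auto
  have inj: "inj_on (\<lambda>a. card {x \<in> A. x < a}) A"
  proof (rule inj_onI)
    fix a b assume "a \<in> A" "b \<in> A" "card {x \<in> A. x < a} = card {x \<in> A. x < b}"
    then show "a = b" using less[of a b] less[of b a] by (cases a b rule: linorder_cases) auto
  qed
  have "(\<lambda>a. card {x \<in> A. x < a}) ` A \<subseteq> {..<card A}"
    using assms by (auto intro!: psubset_card_mono)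
  then have "(\<lambda>a. card {x \<in> A. x < a}) ` A = {..<card A}"
    by (intro card_subset_eq) (auto simp: card_image inj)
  with inj show ?thesis by (simp add: bij_betw_def)
qed

lemma card_free_rows:
  assumes "C \<in> rook_placements n k"
  shows "card ({1..n} - fst ` C) = n - k"
proof -
  have C: "C \<subseteq> board n" "card C = k" "inj_on fst C"
    using assms by (auto simp: rook_placements_def)
  then have "fst ` C \<subseteq> {1..n}" by (auto simp: board_def)
  then show ?thesis using C finite_subset[of "fst ` C" "{1..n}"]
    by (simp add: card_Diff_subset card_image)
qed

text \<open>There are \<open>n - k'\<close> free rows, so the rank of the new rook is below
  \<open>n - k'\<close> and its exponent lies between \<open>k'\<close> and
  \<open>n - 1\<close>.\<close>

lemma weight_seq_col_weights:
  "C \<in> rook_placements n k \<Longrightarrow> weight_seq n k (map (col_weight n C) [1..<n + 1])"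
proof (induction n arbitrary: C k)
  case 0
  then show ?case by (simp add: rook_placements_0 weight_seq_Nil)
next
  case (Suc n)
  from Suc.prems show ?case
  proof (cases rule: rook_placements_Suc_cases)
    case empty
    then show ?thesis
      unfolding col_weights_Suc last_col_weight_empty[OF empty]
      by (intro weight_seq_first Suc.IH)
  next
    case (rook r C' k')
    have "card {i \<in> {1..n} - fst ` C'. i < r} \<in> {..<card ({1..n} - fst ` C')}"
      by (rule bspec[OF bij_betwE[OF bij_betw_rank] rook(3)]) simp
    then have "card {i \<in> {1..n} - fst ` C'. i < r} < n - k'"
      unfolding card_free_rows[OF rook(2)] by (rule lessThan_iff[THEN iffD1])
    then show ?thesis
      unfolding rook(1,4) col_weights_Suc_insert
        last_col_weight_rook[OF rook(2,3)]
      by (intro weight_seq_later Suc.IH rook(2)) auto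
  qed
qed

text \<open>The last weight tells whether the last column has a rook; the earlier weights fix the
  rest of the placement by induction, and then the exponent fixes the row.\<close>

lemma col_weights_inject:
  "C \<in> rook_placements n k \<Longrightarrow> D \<in> rook_placements n l \<Longrightarrow>
    map (col_weight n C) [1..<n + 1] = map (col_weight n D) [1..<n + 1] \<Longrightarrow> C = D"
proof (induction n arbitrary: C D k l)
  case 0
  then show ?case by (simp add: rook_placements_0)
next
  case (Suc n)
  note eq = Suc.prems(3)
  from Suc.prems(1) show ?case
  proof (cases rule: rook_placements_Suc_cases)
    case C: empty
    from Suc.prems(2) show ?thesis
    proof (cases rule: rook_placements_Suc_cases)
      case D: empty
      show ?thesis
        using eq unfolding col_weights_Suc
        by (intro Suc.IH[OF C D]) blast
    next
      case D: (rook r D' l')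
      show ?thesis
        using eq q_power_neq
        unfolding D(4) col_weights_Suc[of n C] col_weights_Suc_insert
          last_col_weight_empty[OF C] last_col_weight_rook[OF D(2,3)] by blast
    qed
  next
    case C: (rook r C' k')
    from Suc.prems(2) show ?thesis
    proof (cases rule: rook_placements_Suc_cases)
      case D: empty
      show ?thesis
        using eq[symmetric] q_power_neq
        unfolding C(4) col_weights_Suc[of n D] col_weights_Suc_insert
          last_col_weight_empty[OF D] last_col_weight_rook[OF C(2,3)] by blast
    next
      case D: (rook s D' l')
      note eq' = eq[unfolded C(4) D(4) col_weights_Suc_insert
          last_col_weight_rook[OF C(2,3)] last_col_weight_rook[OF D(2,3)]]
      have CD: "C' = D'" using eq' by (intro Suc.IH[OF C(2) D(2)]) blast
      \<comment> \<open>With equal rook counts, equal exponents mean equal ranks among the same free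
        rows.\<close>
      then have "k' = l'" using C(2) D(2) by (auto simp: rook_placements_def)
      with eq' have "card {i \<in> {1..n} - fst ` C'. i < r} = card {i \<in> {1..n} - fst ` C'. i < s}"
        by (simp add: CD q_minus_1_power_eq_iff del: mult_cancel_left)
      then have "r = s"
        using bij_betw_rank[of "{1..n} - fst ` C'"] C(3) D(3) CD
        unfolding bij_betw_def inj_on_def by blast
      then show ?thesis using C(4) D(4) CD by simp
    qed
  qed
qed

lemma rook_placement_exists:
  "weight_seq n k ws \<Longrightarrow> \<exists>C \<in> rook_placements n k. map (col_weight n C) [1..<n + 1] = ws"
proof (induction rule: weight_seq.induct)
  case weight_seq_Nil
  then show ?case by (simp add: Bex_def rook_placements_0)
next
  case (weight_seq_first n k ws)
  then obtain C where C: "C \<in> rook_placements n k" "map (col_weight n C) [1..<n + 1] = ws"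
    by blast
  then have "map (col_weight (Suc n) C) [1..<Suc n + 1] = ws @ [q ^ k]"
    by (simp only: col_weights_Suc last_col_weight_empty)
  with C show ?case using rook_placements_SucI1 by blast
next
  case (weight_seq_later n k ws e)
  then obtain C where C: "C \<in> rook_placements n k" "map (col_weight n C) [1..<n + 1] = ws"
    by blast
  \<comment> \<open>The occupied rows account for \<open>k\<close> of the exponent, so the new rook
    must have rank \<open>e - k\<close> among the \<open>n - k\<close> free rows.\<close>
  have "e - k \<in> {..<card ({1..n} - fst ` C)}"
    using weight_seq_later by (simp only: card_free_rows[OF C(1)]) auto
  then obtain r where r: "r \<in> {1..n} - fst ` C" "card {i \<in> {1..n} - fst ` C. i < r} = e - k"
    using bij_betw_rank[of "{1..n} - fst ` C"] unfolding bij_betw_def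
    by (metis (no_types, lifting) finite_Diff finite_atLeastAtMost imageE)
  let ?D = "insert (r, Suc n) C"
  have "map (col_weight (Suc n) ?D) [1..<Suc n + 1] = ws @ [(q - 1) * q ^ (k + (e - k))]"
    by (simp only: col_weights_Suc_insert C(2)
        last_col_weight_rook[OF C(1) r(1)] r(2))
  then show ?case
    using rook_placements_SucI2[OF C(1) r(1)] weight_seq_later by auto
qed

lemma bij_betw_rook_placements_weight_seq:
  "bij_betw (\<lambda>C. map (col_weight n C) [1..<n + 1]) (rook_placements n k) {ws. weight_seq n k ws}"
  unfolding bij_betw_def
proof
  show "inj_on (\<lambda>C. map (col_weight n C) [1..<n + 1]) (rook_placements n k)"
    using col_weights_inject by (rule inj_onI)
  show "(\<lambda>C. map (col_weight n C) [1..<n + 1]) ` rook_placements n k = {ws. weight_seq n k ws}"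
    using weight_seq_col_weights rook_placement_exists by blast
qed

section \<open>Composition of the two bijections\<close>

theorem theorem3p7:
  fixes n k :: nat
  assumes "1 \<le> n" and "k \<le> n - 1"
  shows "bij_betw (Phi n k) (rook_placements n k) (zpaths n (n - k)) \<and>
         (\<forall>C \<in> rook_placements n k. placement_weight n C = path_weight (Phi n k C))"
proof -
  let ?f = "\<lambda>C. map (col_weight n C) [1..<n + 1]"
  let ?g = "the_inv_into (zpaths n (n - k)) (map edge_weight)"
  note f = bij_betw_rook_placements_weight_seq[of n k]
  have g: "bij_betw (map edge_weight) (zpaths n (n - k)) {ws. weight_seq n k ws}"
    using assms by (intro bij_betw_zpaths_weight_seq) linarith
  \<comment> \<open>The description in \<open>Phi\<close> unfolds literally to that of
    \<open>the_inv_into\<close>, so reflexivity suffices.\<close>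
  have Phi: "Phi n k = ?g \<circ> ?f"
    unfolding Phi_def the_inv_into_def comp_def by (rule refl)
  have "bij_betw (Phi n k) (rook_placements n k) (zpaths n (n - k))"
    unfolding Phi using f bij_betw_the_inv_into[OF g] by (rule bij_betw_trans)
  moreover have "placement_weight n C = path_weight (Phi n k C)" if "C \<in> rook_placements n k" for C
  proof -
    \<comment> \<open>Lying in the range of the path encoding is what makes the described path exist
      and have the weights \<open>?f C\<close>.\<close>
    have "?f C \<in> {ws. weight_seq n k ws}" using bij_betwE[OF f] that by (rule bspec)
    then have "map edge_weight (Phi n k C) = ?f C"
      unfolding Phi comp_def by (rule f_the_inv_into_f_bij_betw[OF g])
    then have "path_weight (Phi n k C) = prod_list (?f C)" by (simp only: path_weight_def)
    also have "\<dots> = (\<Prod>i\<in>set [1..<n + 1]. col_weight n C i)"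
      by (rule prod.distinct_set_conv_list[symmetric]) simp
    also have "set [1..<n + 1] = {1..n}" by auto
    finally show ?thesis by (simp add: placement_weight_def)
  qed
  ultimately show ?thesis by blast
qed

end
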